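(* Let $\lambda>0$ and let $\hat\beta$ be the square-root Lasso, i.e. a minimizer over $\beta\in\mathbb{R}^p$ of $\|Y-X\beta\|_n+\lambda\|\beta\|_1$, where $Y=X\beta^0+\epsilon$. Let $\lambda_0>0$ satisfy $\lambda_0\|\epsilon\|_n\ge\|\epsilon^TX\|_\infty/n$. Suppose that for $\eta=\sqrt2-1$ one has $\lambda\eta>\lambda_0$ and $$\|\beta^0\|_1\le\|\epsilon\|_n\Big(\frac{\lambda\eta-\lambda_0}{2\lambda_0\lambda}\Big).$$ Let $0\le\delta<1$ be arbitrary and define $$L:=\frac{\lambda\eta+\lambda_0+\delta(\lambda\eta-\lambda_0)}{(1-\delta)(\lambda\eta-\lambda_0)}.$$ Then $$2\delta(\lambda\eta-\lambda_0)\|\epsilon\|_n\|\hat\beta-\beta^0\|_1+\|X(\hat\beta-\beta^0)\|_n^2$$ $$\le\min_{S\subset\{1,\dots,p\}}\Big\{\min_{\beta\in\mathbb{R}^p,\ S_\beta=S}\Big[2\delta(\lambda\eta-\lambda_0)\|\epsilon\|_n\|\beta-\beta^0\|_1+\|X(\beta-\beta^0)\|_n^2\Big]$$ $$+\Big(\frac{\lambda\eta+\lambda_0+\delta(\lambda\eta-\lambda_0)}{\eta}\Big)^2\Big(\frac{\lambda\eta+\lambda_0}{2\lambda_0}\Big)^2\frac{\|\epsilon\|_n^2|S|}{\hat\phi^2(L,S)}\Big\}.$$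
   Context: $X$ is a fixed $n\times p$ real matrix of rank $n$, $Y\in\mathbb{R}^n$, $f^0=\mathbb{E}Y$, $\beta^0\in\mathbb{R}^p$ is a solution of $X\beta^0=f^0$, and $\epsilon:=Y-f^0$, so $Y=X\beta^0+\epsilon$ (the result is deterministic: it holds for any realization of $\epsilon$). For $v\in\mathbb{R}^n$, $\|v\|_n:=\sqrt{v^Tv/n}$. For $\beta\in\mathbb{R}^p$, $S_\beta:=\{j:\beta_j\ne0\}$. For $S\subset\{1,\dots,p\}$, $\beta_S\in\mathbb{R}^p$ has entries $\beta_j$ for $j\in S$ and $0$ otherwise. The compatibility constant, for $L>0$, is $$\hat\phi^2(L,S):=\min\{|S|\,\|X\beta_S-X\beta_{S^c}\|_n^2:\ \|\beta_S\|_1=1,\ \|\beta_{S^c}\|_1\le L\}.$$ Conventions: minima over $\beta$ with $S_\beta=S$ are understood as infima (i.e. the inequality holds for every $\beta$, with $S=S_\beta$); the term containing $|S|/\hat\phi^2(L,S)$ is $0$ if $S=\emptyset$ and $+\infty$ if $S\ne\emptyset$ and $\hat\phi(L,S)=0$. *)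

theory Defs
  imports "HOL-Analysis.Analysis"
begin

definition norm_n :: "real ^ 'n \<Rightarrow> real"
  where "norm_n v = sqrt ((v \<bullet> v) / real CARD('n))"

definition norm_l1 :: "real ^ 'p \<Rightarrow> real"
  where "norm_l1 \<beta> = (\<Sum>j\<in>UNIV. \<bar>\<beta> $ j\<bar>)"

definition supp_vec :: "real ^ 'p \<Rightarrow> 'p set"
  where "supp_vec \<beta> = {j. \<beta> $ j \<noteq> 0}"

definition restrict_vec :: "'p set \<Rightarrow> real ^ 'p \<Rightarrow> real ^ 'p"
  where "restrict_vec S \<beta> = (\<chi> j. if j \<in> S then \<beta> $ j else 0)"

definition sqrt_lasso :: "real ^ 'p ^ 'n \<Rightarrow> real ^ 'n \<Rightarrow> real \<Rightarrow> real ^ 'p \<Rightarrow> bool"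
  where "sqrt_lasso X Y lam \<beta>hat \<longleftrightarrow>
    is_arg_min (\<lambda>\<beta>. norm_n (Y - X *v \<beta>) + lam * norm_l1 \<beta>) (\<lambda>_. True) \<beta>hat"

definition compat_feasible :: "real \<Rightarrow> 'p set \<Rightarrow> (real ^ 'p) set"
  where "compat_feasible L S =
    {\<beta>. norm_l1 (restrict_vec S \<beta>) = 1 \<and> norm_l1 (restrict_vec (- S) \<beta>) \<le> L}"

text \<open>
  The squared compatibility constant. The infimum is attained for nonempty \<open>S\<close> and \<open>L \<ge> 0\<close>, see
  \<open>compat_sq_attained\<close> below. For \<open>S = {}\<close> the feasible set is empty and the value is meaningless.
\<close>

definition compat_sq :: "real ^ 'p ^ 'n \<Rightarrow> real \<Rightarrow> 'p set \<Rightarrow> real"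
  where "compat_sq X L S =
    (INF \<beta>\<in>compat_feasible L S.
       real (card S) * (norm_n (X *v restrict_vec S \<beta> - X *v restrict_vec (- S) \<beta>))\<^sup>2)"

text \<open>
  The extended real \<open>c * card S / compat_sq X L S\<close>. The factor \<open>c\<close> is an argument because the
  conventions (\<open>0\<close> for empty \<open>S\<close>, \<open>\<infinity>\<close> for nonempty \<open>S\<close> with vanishing compatibility constant)
  apply to the whole product, whereas \<open>0 * \<infinity> = 0\<close> for extended reals.
\<close>

definition compat_term :: "real \<Rightarrow> real ^ 'p ^ 'n \<Rightarrow> real \<Rightarrow> 'p set \<Rightarrow> ereal"
  where "compat_term c X L S =
    (if S = {} then 0
     else if compat_sq X L S = 0 then \<infinity>
     else ereal (c * real (card S) / compat_sq X L S))"

lemma compat_sq_attained: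
  fixes X :: "real ^ 'p ^ 'n"
  assumes "S \<noteq> {}" and "0 \<le> L"
  shows "\<exists>\<beta>\<in>compat_feasible L S. compat_sq X L S =
    real (card S) * (norm_n (X *v restrict_vec S \<beta> - X *v restrict_vec (- S) \<beta>))\<^sup>2"
proof -
  let ?F = "compat_feasible L S"
  let ?g = "\<lambda>\<beta>. real (card S) * (norm_n (X *v restrict_vec S \<beta> - X *v restrict_vec (- S) \<beta>))\<^sup>2"
  obtain j where j: "j \<in> S" using assms by blast
  have "norm_l1 (restrict_vec S (axis j 1)) = (\<Sum>i\<in>UNIV. if i = j then 1 else 0)"
    unfolding norm_l1_def by (rule sum.cong) (use j in \<open>auto simp: restrict_vec_def axis_def\<close>)
  moreover have "norm_l1 (restrict_vec (- S) (axis j 1)) = 0"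
    unfolding norm_l1_def by (rule sum.neutral) (use j in \<open>auto simp: restrict_vec_def axis_def\<close>)
  ultimately have ne: "?F \<noteq> {}"
    using assms by (auto simp: compat_feasible_def intro!: exI[of _ "axis j 1"])
  have cr: "continuous_on UNIV (restrict_vec T)" for T :: "'p set"
    unfolding restrict_vec_def
  proof (intro continuous_on_vec_lambda)
    fix i show "continuous_on UNIV (\<lambda>\<beta>::real^'p. if i \<in> T then \<beta> $ i else 0)"
      by (cases "i \<in> T") (auto intro!: continuous_intros)
  qed
  have cl: "continuous_on UNIV (\<lambda>\<beta>. norm_l1 (restrict_vec T \<beta>))" for T :: "'p set"
    unfolding norm_l1_def by (intro continuous_intros cr)
  have "closed ?F"
    unfolding compat_feasible_def
    by (intro closed_Collect_conj closed_Collect_eq closed_Collect_le cl continuous_intros)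
  moreover have "bounded ?F"
  proof (rule boundedI)
    fix \<beta> assume b: "\<beta> \<in> ?F"
    have "norm \<beta> \<le> (\<Sum>i\<in>UNIV. \<bar>\<beta> $ i\<bar>)" by (rule norm_le_l1_cart)
    also have "\<dots> = norm_l1 (restrict_vec S \<beta>) + norm_l1 (restrict_vec (- S) \<beta>)"
      unfolding norm_l1_def sum.distrib[symmetric] restrict_vec_def by (rule sum.cong) auto
    also have "\<dots> \<le> 1 + L" using b by (simp add: compat_feasible_def)
    finally show "norm \<beta> \<le> 1 + L" .
  qed
  ultimately have "compact ?F" by (simp add: compact_eq_bounded_closed)
  moreover have "continuous_on ?F ?g"
    unfolding norm_n_def
    by (intro continuous_intros continuous_on_subset[OF cr]
        continuous_on_compose2[OF matrix_vector_mult_linear_continuous_on]) auto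
  ultimately obtain b where b: "b \<in> ?F" "\<forall>y\<in>?F. ?g b \<le> ?g y"
    using continuous_attains_inf ne by blast
  then have "compat_sq X L S = ?g b"
    unfolding compat_sq_def by (intro cInf_eq_minimum) auto
  with b show ?thesis by blast
qed

end

theory Submission
  imports Defs
begin

text \<open>
  Write \<open>e\<close> and \<open>r\<close> for the empirical norms of \<open>\<epsilon>\<close> and of the residual \<open>Y - X \<beta>hat\<close>. Comparing
  the objective at \<open>\<beta>hat\<close> and \<open>\<beta>0\<close> gives \<open>r \<le> (lam * \<eta> + lam0) / (2 * lam0) * e\<close> and a bound for the
  l1-norm of \<open>\<beta>hat\<close>; expanding the square of \<open>\<epsilon> - X (\<beta>hat - \<beta>0)\<close> then gives
  \<open>r\<^sup>2 \<ge> (1 - 2 * \<eta>) * e\<^sup>2 = \<eta>\<^sup>2 * e\<^sup>2\<close>, which is why \<open>\<eta> = sqrt 2 - 1\<close>. The first-order condition is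
  that of the ordinary Lasso with tuning parameter \<open>lam * r\<close>, and \<open>lam0 * e \<le> lam0 * r / \<eta>\<close>, so the
  usual sharp Lasso argument applies: either the inner product of \<open>X (\<beta>hat - \<beta>)\<close> and
  \<open>X (\<beta>hat - \<beta>0)\<close> is already negative enough, or \<open>\<beta>hat - \<beta>\<close> lies in the cone on which the
  compatibility constant bounds its l1-norm on the support of \<open>\<beta>\<close>.
\<close>

section \<open>Empirical norm, l1-norm and the bound on the noise term\<close>

lemma norm_n_nonneg [simp]: "0 \<le> norm_n v"
  by (simp add: norm_n_def)

lemma norm_n_power2: "(norm_n (v :: real ^ 'n))\<^sup>2 = (v \<bullet> v) / real CARD('n)"
  by (simp add: norm_n_def)

lemma norm_n_eq_0_iff [simp]: "norm_n v = 0 \<longleftrightarrow> v = 0"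
  by (simp add: norm_n_def)

lemma norm_n_scaleR: "norm_n (c *\<^sub>R v) = \<bar>c\<bar> * norm_n v"
proof -
  have "(norm_n (c *\<^sub>R v))\<^sup>2 = (\<bar>c\<bar> * norm_n v)\<^sup>2"
    by (simp add: norm_n_power2 power_mult_distrib) (simp add: power2_eq_square)
  then show ?thesis
    by (simp only: power2_eq_iff_nonneg[OF norm_n_nonneg] mult_nonneg_nonneg abs_ge_zero norm_n_nonneg)
qed

lemma norm_l1_nonneg [simp]: "0 \<le> norm_l1 b"
  by (simp add: norm_l1_def sum_nonneg)

lemma norm_l1_triangle: "norm_l1 (a + b) \<le> norm_l1 a + norm_l1 b"
  unfolding norm_l1_def sum.distrib[symmetric] by (rule sum_mono) simp

lemma norm_l1_diff_triangle: "norm_l1 (a - c) \<le> norm_l1 (a - b) + norm_l1 (b - c)"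
  using norm_l1_triangle[of "a - b" "b - c"] by simp

lemma norm_l1_scaleR: "norm_l1 (c *\<^sub>R b) = \<bar>c\<bar> * norm_l1 b"
  by (simp add: norm_l1_def abs_mult sum_distrib_left)

lemma norm_l1_minus [simp]: "norm_l1 (- b) = norm_l1 b"
  by (simp add: norm_l1_def)

lemma norm_l1_diff_le: "norm_l1 (a - b) \<le> norm_l1 a + norm_l1 b"
  using norm_l1_triangle[of a "- b"] by simp

lemma norm_l1_restrict_split:
  "norm_l1 b = norm_l1 (restrict_vec S b) + norm_l1 (restrict_vec (- S) b)"
  unfolding norm_l1_def sum.distrib[symmetric] restrict_vec_def by (rule sum.cong) auto

text \<open>Coordinatewise: on the support of \<open>b\<close> this is the triangle inequality, and
  off it \<open>b $ j = 0\<close> makes both sides equal.\<close>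

lemma norm_l1_diff_supp:
  "norm_l1 b - norm_l1 a \<le>
    norm_l1 (restrict_vec (supp_vec b) (a - b)) - norm_l1 (restrict_vec (- supp_vec b) (a - b))"
  unfolding norm_l1_def sum_subtractf[symmetric] restrict_vec_def supp_vec_def
  by (rule sum_mono) auto

lemma inner_le_infnorm_norm_l1: "u \<bullet> b \<le> infnorm u * norm_l1 (b :: real ^ 'p)"
proof -
  have "u $ j * b $ j \<le> infnorm u * \<bar>b $ j\<bar>" for j
  proof -
    have "u $ j * b $ j \<le> \<bar>u $ j\<bar> * \<bar>b $ j\<bar>"
      by (metis abs_ge_self abs_mult)
    also have "\<dots> \<le> infnorm u * \<bar>b $ j\<bar>"
      by (intro mult_right_mono component_le_infnorm_cart) simp
    finally show ?thesis .
  qed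
  then show ?thesis
    unfolding inner_vec_def norm_l1_def sum_distrib_left by (intro sum_mono) simp
qed

lemma noise_inner_bound:
  fixes X :: "real ^ 'p ^ 'n"
  assumes "infnorm (\<epsilon> v* X) / real CARD('n) \<le> c"
  shows "\<epsilon> \<bullet> (X *v h) / real CARD('n) \<le> c * norm_l1 h"
proof -
  have "\<epsilon> \<bullet> (X *v h) \<le> infnorm (\<epsilon> v* X) * norm_l1 h"
    using inner_le_infnorm_norm_l1[of "\<epsilon> v* X" h] by (simp add: dot_lmul_matrix)
  then have "\<epsilon> \<bullet> (X *v h) / real CARD('n) \<le> infnorm (\<epsilon> v* X) / real CARD('n) * norm_l1 h"
    by (simp add: divide_right_mono)
  also have "\<dots> \<le> c * norm_l1 h"
    using assms by (intro mult_right_mono) simp_all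
  finally show ?thesis .
qed

section \<open>Optimality conditions of the square-root Lasso\<close>

lemma sqrt_lasso_le:
  assumes "sqrt_lasso X Y lam b"
  shows "norm_n (Y - X *v b) + lam * norm_l1 b \<le> norm_n (Y - X *v a) + lam * norm_l1 a"
  using assms unfolding sqrt_lasso_def is_arg_min_def by (meson linorder_not_less)

text \<open>Small \<open>t\<close> serves the first-order condition; \<open>t = 1\<close> serves the
  residual expansion and polarization.\<close>

lemma norm_n_diff_scaleR_power2:
  fixes r v :: "real ^ 'n"
  shows "(norm_n (r - t *\<^sub>R v))\<^sup>2
    = (norm_n r)\<^sup>2 - 2 * t * (r \<bullet> v / real CARD('n)) + t\<^sup>2 * (norm_n v)\<^sup>2"
  unfolding norm_n_power2
  by (simp add: inner_diff_left inner_diff_right inner_commute[of v r] field_simps)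
     (simp add: power2_eq_square algebra_simps)

text \<open>Comparing \<open>b\<close> with nearby points of the segment towards \<open>a\<close>
  replaces subgradient calculus. The factor \<open>norm_n (Y - X *v b)\<close> comes from
  linearizing the norm, which breaks down at a zero residual; there both sides are 0.\<close>

lemma sqrt_lasso_first_order:
  fixes X :: "real ^ 'p ^ 'n"
  assumes lasso: "sqrt_lasso X Y lam b" and "0 \<le> lam"
  shows "(Y - X *v b) \<bullet> (X *v (a - b)) / real CARD('n)
    \<le> lam * norm_n (Y - X *v b) * (norm_l1 a - norm_l1 b)"
proof (cases "Y - X *v b = 0")
  case True
  then show ?thesis by (simp add: norm_n_def)
next
  case False
  define r where "r = Y - X *v b"
  define v where "v = X *v (a - b)"
  define q where "q = r \<bullet> v / real CARD('n)"
  define e where "e = norm_n r"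
  define D where "D = norm_l1 a - norm_l1 b"
  have e: "0 < e"
    using False norm_n_nonneg[of r] norm_n_eq_0_iff[of r] unfolding e_def r_def by linarith
  have step: "q \<le> lam * e * D + t * ((norm_n v)\<^sup>2 / 2)" if t: "0 < t" "t < 1" for t
  proof -
    \<comment> \<open>By convexity the penalty grows at most linearly in \<open>t\<close> along the
      segment.\<close>
    have "norm_l1 (b + t *\<^sub>R (a - b)) = norm_l1 ((1 - t) *\<^sub>R b + t *\<^sub>R a)"
      by (simp add: algebra_simps)
    also have "\<dots> \<le> norm_l1 b + t * D"
      using norm_l1_triangle[of "(1 - t) *\<^sub>R b" "t *\<^sub>R a"] t
      by (simp add: norm_l1_scaleR D_def left_diff_distrib right_diff_distrib)
    finally have pen: "lam * norm_l1 (b + t *\<^sub>R (a - b)) \<le> lam * (norm_l1 b + t * D)"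
      using \<open>0 \<le> lam\<close> by (rule mult_left_mono)
    have "Y - X *v (b + t *\<^sub>R (a - b)) = r - t *\<^sub>R v"
      by (simp add: r_def v_def matrix_vector_right_distrib matrix_vector_mult_scaleR)
    then have "e + lam * norm_l1 b \<le> norm_n (r - t *\<^sub>R v) + lam * norm_l1 (b + t *\<^sub>R (a - b))"
      using sqrt_lasso_le[OF lasso, of "b + t *\<^sub>R (a - b)"] unfolding e_def r_def by metis
    with pen have "e - lam * t * D \<le> norm_n (r - t *\<^sub>R v)"
      by (simp add: distrib_left mult.assoc)
    \<comment> \<open>Bounding the product by a sum of squares passes to squared norms whatever the
      sign of \<open>e - lam * t * D\<close>; the loss is quadratic in \<open>t\<close> and vanishes
      in the limit.\<close>
    then have "2 * e * (e - lam * t * D) \<le> 2 * e * norm_n (r - t *\<^sub>R v)"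
      using e by simp
    also have "\<dots> \<le> e\<^sup>2 + (norm_n (r - t *\<^sub>R v))\<^sup>2"
      by (rule sum_squares_bound)
    also have "\<dots> = 2 * e\<^sup>2 - 2 * t * q + t\<^sup>2 * (norm_n v)\<^sup>2"
      by (simp add: norm_n_diff_scaleR_power2 e_def q_def)
    finally have "t * (2 * q) \<le> t * (2 * (lam * e * D) + t * (norm_n v)\<^sup>2)"
      by (simp add: power2_eq_square algebra_simps)
    then show ?thesis using t by simp
  qed
  have "q \<le> lam * e * D"
  proof (rule tendsto_lowerbound)
    have "((\<lambda>t. lam * e * D + t * ((norm_n v)\<^sup>2 / 2)) \<longlongrightarrow> lam * e * D + 0 * ((norm_n v)\<^sup>2 / 2))
      (at_right 0)"
      by (intro tendsto_intros)
    then show "((\<lambda>t. lam * e * D + t * ((norm_n v)\<^sup>2 / 2)) \<longlongrightarrow> lam * e * D) (at_right 0)"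
      by simp
    show "\<forall>\<^sub>F t in at_right 0. q \<le> lam * e * D + t * ((norm_n v)\<^sup>2 / 2)"
      using step eventually_at_right_less[of "0::real"]
      by (auto simp: eventually_at_right_field intro!: exI[of _ 1])
  qed simp
  then show ?thesis by (simp add: q_def r_def v_def e_def D_def)
qed

section \<open>Residual norm versus noise level\<close>

text \<open>The noise is controlled by \<open>norm_n \<epsilon>\<close>, whereas the effective
  penalty is \<open>lam\<close> times the residual norm; the two bounds convert between these
  scales.\<close>

lemma sqrt_lasso_residual_bounds:
  fixes X :: "real ^ 'p ^ 'n"
  assumes lasso: "sqrt_lasso X (X *v \<beta>0 + \<epsilon>) lam b"
    and pos: "lam > 0" "lam0 > 0"
    and noise: "infnorm (\<epsilon> v* X) / real CARD('n) \<le> lam0 * norm_n \<epsilon>"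
    and eta: "\<eta> = sqrt 2 - 1"
    and small: "norm_l1 \<beta>0 \<le> norm_n \<epsilon> * ((lam * \<eta> - lam0) / (2 * lam0 * lam))"
  shows "\<eta> * norm_n \<epsilon> \<le> norm_n (X *v \<beta>0 + \<epsilon> - X *v b)" (is ?lower)
    and "norm_n (X *v \<beta>0 + \<epsilon> - X *v b) \<le> (lam * \<eta> + lam0) / (2 * lam0) * norm_n \<epsilon>" (is ?upper)
proof -
  define e where "e = norm_n \<epsilon>"
  define r where "r = norm_n (X *v \<beta>0 + \<epsilon> - X *v b)"
  have e0: "0 \<le> e" and r0: "0 \<le> r" by (simp_all add: e_def r_def)
  have basic: "r + lam * norm_l1 b \<le> e + lam * norm_l1 \<beta>0"
    using sqrt_lasso_le[OF lasso, of \<beta>0] by (simp add: e_def r_def)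
  have small': "2 * lam0 * (lam * norm_l1 \<beta>0) \<le> e * (lam * \<eta> - lam0)"
    using small pos by (simp add: e_def field_simps)
  \<comment> \<open>The penalty of \<open>b\<close> is dropped, and \<open>small'\<close> adds
    \<open>lam * \<eta> - lam0\<close> to the coefficient \<open>2 * lam0\<close> of
    \<open>e\<close>.\<close>
  have "2 * lam0 * r \<le> 2 * lam0 * (e + lam * norm_l1 \<beta>0)"
    using basic pos mult_nonneg_nonneg[OF less_imp_le[OF pos(1)] norm_l1_nonneg[of b]]
    by (intro mult_left_mono) linarith+
  also have "\<dots> \<le> (lam * \<eta> + lam0) * e"
    using small' by (simp add: algebra_simps)
  finally show ?upper
    using pos by (simp add: e_def r_def field_simps)
  have q: "\<epsilon> \<bullet> (X *v (b - \<beta>0)) / real CARD('n) \<le> lam0 * e * norm_l1 (b - \<beta>0)"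
    using noise_inner_bound[OF noise] by (simp add: e_def)
  have "X *v \<beta>0 + \<epsilon> - X *v b = \<epsilon> - 1 *\<^sub>R (X *v (b - \<beta>0))"
    by (simp add: matrix_vector_mult_diff_distrib)
  then have rsq: "r\<^sup>2 = e\<^sup>2 - 2 * (\<epsilon> \<bullet> (X *v (b - \<beta>0)) / real CARD('n)) + (norm_n (X *v (b - \<beta>0)))\<^sup>2"
    unfolding r_def e_def by (simp only: norm_n_diff_scaleR_power2) simp
  \<comment> \<open>Here \<open>small'\<close> enters twice, and \<open>lam0\<close> cancels:
    \<open>2 * lam0 + 2 * (lam * \<eta> - lam0) = 2 * lam * \<eta>\<close>.\<close>
  have "2 * lam0 * (lam * norm_l1 (b - \<beta>0)) \<le> 2 * lam0 * (lam * norm_l1 b + lam * norm_l1 \<beta>0)"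
    using norm_l1_diff_le[of b \<beta>0] pos by (simp add: distrib_left[symmetric])
  also have "\<dots> \<le> 2 * lam0 * (e + 2 * (lam * norm_l1 \<beta>0))"
    using basic r0 pos by simp
  also have "\<dots> \<le> lam * (2 * \<eta> * e)"
    using small' by (simp add: algebra_simps)
  finally have "lam * (2 * lam0 * norm_l1 (b - \<beta>0)) \<le> lam * (2 * \<eta> * e)"
    by (simp add: algebra_simps)
  then have "2 * lam0 * norm_l1 (b - \<beta>0) \<le> 2 * \<eta> * e"
    using pos by simp
  then have "e * (2 * lam0 * norm_l1 (b - \<beta>0)) \<le> e * (2 * \<eta> * e)"
    using e0 by (rule mult_left_mono)
  moreover have "2 * (lam0 * e * norm_l1 (b - \<beta>0)) = e * (2 * lam0 * norm_l1 (b - \<beta>0))"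
    by simp
  ultimately have "2 * (\<epsilon> \<bullet> (X *v (b - \<beta>0)) / real CARD('n)) \<le> e * (2 * \<eta> * e)"
    using q by linarith
  then have "e\<^sup>2 - e * (2 * \<eta> * e) \<le> r\<^sup>2"
    using rsq zero_le_power2[of "norm_n (X *v (b - \<beta>0))"] by linarith
  moreover have "\<eta>\<^sup>2 = 1 - 2 * \<eta>"
    by (simp add: eta power2_diff)
  then have "(\<eta> * e)\<^sup>2 = e\<^sup>2 - e * (2 * \<eta> * e)"
    by (simp add: power_mult_distrib left_diff_distrib) (simp add: power2_eq_square)
  ultimately show ?lower
    using r0 power2_le_imp_le[of "\<eta> * e" r] by (simp add: e_def r_def)
qed

section \<open>Compatibility constant and quadratic bounds\<close>

lemma compat_sq_le:
  fixes X :: "real ^ 'p ^ 'n"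
  assumes "b \<in> compat_feasible L S"
  shows "compat_sq X L S \<le>
    real (card S) * (norm_n (X *v restrict_vec S b - X *v restrict_vec (- S) b))\<^sup>2"
  unfolding compat_sq_def
  by (rule cINF_lower[OF _ assms]) (rule bdd_belowI2[of _ 0], simp)

text \<open>By homogeneity: once \<open>h\<close> is scaled to l1-norm 1 on \<open>S\<close>, the
  cone condition becomes the feasibility bound \<open>L\<close>.\<close>

lemma compat_sq_cone:
  fixes X :: "real ^ 'p ^ 'n"
  assumes pos: "0 < norm_l1 (restrict_vec S h)"
    and cone: "norm_l1 (restrict_vec (- S) h) \<le> L * norm_l1 (restrict_vec S h)"
  shows "compat_sq X L S * (norm_l1 (restrict_vec S h))\<^sup>2 \<le> real (card S) * (norm_n (X *v h))\<^sup>2"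
proof -
  define m where "m = norm_l1 (restrict_vec S h)"
  \<comment> \<open>The compatibility constant is defined with \<open>X b_S - X b_{-S}\<close>, whence the sign flip off \<open>S\<close>.\<close>
  define b where "b = (1 / m) *\<^sub>R (restrict_vec S h - restrict_vec (- S) h)"
  have bS: "restrict_vec S b = (1 / m) *\<^sub>R restrict_vec S h"
    and bC: "restrict_vec (- S) b = - ((1 / m) *\<^sub>R restrict_vec (- S) h)"
    by (auto simp: b_def restrict_vec_def vec_eq_iff)
  have m: "0 < m" using pos by (simp add: m_def)
  have "b \<in> compat_feasible L S"
    using m cone by (simp add: compat_feasible_def bS bC norm_l1_scaleR m_def[symmetric] field_simps)
  moreover have "restrict_vec S h + restrict_vec (- S) h = h"
    by (auto simp: restrict_vec_def vec_eq_iff)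
  then have "X *v restrict_vec S b - X *v restrict_vec (- S) b = (1 / m) *\<^sub>R (X *v h)"
    unfolding bS bC
    by (metis diff_minus_eq_add matrix_vector_mult_diff_distrib matrix_vector_mult_scaleR scaleR_right_distrib)
  ultimately have "compat_sq X L S \<le> real (card S) * (norm_n ((1 / m) *\<^sub>R (X *v h)))\<^sup>2"
    using compat_sq_le[of b L S X] by simp
  then show ?thesis
    using m by (simp add: norm_n_scaleR m_def[symmetric] power_mult_distrib power_divide field_simps)
qed

lemma compat_sq_nonneg:
  fixes X :: "real ^ 'p ^ 'n"
  assumes "S \<noteq> {}" "0 \<le> L"
  shows "0 \<le> compat_sq X L S"
  using compat_sq_attained[OF assms, of X] by auto

text \<open>Young's inequality with weight \<open>sqrt (s / \<phi>)\<close>, chosen so that the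
  first assumption bounds the square containing \<open>m\<close> by that of \<open>w\<close>. In the
  application \<open>K\<close> involves the residual norm and \<open>K'\<close> the noise level. If
  \<open>s = 0\<close> the weight degenerates, but then \<open>m = 0\<close>.\<close>

lemma weighted_am_gm_bound:
  fixes m w \<phi> s K K' :: real
  assumes "\<phi> * m\<^sup>2 \<le> s * w\<^sup>2" "0 < \<phi>" "0 \<le> s" "0 \<le> K" "K \<le> K'" "0 \<le> m"
  shows "2 * (K * m) \<le> w\<^sup>2 + K'\<^sup>2 * s / \<phi>"
proof (cases "s = 0")
  case True
  then have "m = 0"
    using assms by (metis mult_zero_left mult_le_0_iff not_less power2_less_eq_zero_iff)
  then show ?thesis using True by simp
next
  case False
  then have s: "0 < s" using assms by simp
  have "2 * (K * m) = 2 * (K * sqrt (s / \<phi>)) * (m / sqrt (s / \<phi>))"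
    using s assms by simp
  also have "\<dots> \<le> (K * sqrt (s / \<phi>))\<^sup>2 + (m / sqrt (s / \<phi>))\<^sup>2"
    by (rule sum_squares_bound)
  also have "\<dots> = K\<^sup>2 * (s / \<phi>) + \<phi> * m\<^sup>2 / s"
    using s assms by (simp add: power_mult_distrib power_divide)
  also have "\<dots> \<le> K'\<^sup>2 * (s / \<phi>) + w\<^sup>2"
    using s assms by (intro add_mono mult_right_mono power_mono) (auto simp: field_simps)
  finally show ?thesis by simp
qed

text \<open>Polarization instead of Cauchy-Schwarz keeps the factor 1 in front of the approximation
  error, which makes the oracle inequality sharp.\<close>

lemma inner_polarization_norm_n:
  fixes u v :: "real ^ 'n"
  shows "2 * (u \<bullet> v / real CARD('n)) = (norm_n u)\<^sup>2 + (norm_n v)\<^sup>2 - (norm_n (u - v))\<^sup>2"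
  using norm_n_diff_scaleR_power2[of u 1 v] by simp

section \<open>Sharp oracle inequality for prediction and l1-error\<close>

theorem theorem1p4p2:
  fixes X :: "real ^ 'p ^ 'n"
    and Y f0 \<epsilon> :: "real ^ 'n"
    and \<beta>0 \<beta>hat :: "real ^ 'p"
    and lam lam0 \<eta> \<delta> L :: real
  assumes rank_X: "rank X = CARD('n)"
    and beta0: "X *v \<beta>0 = f0"
    and noise: "\<epsilon> = Y - f0"
    and lam_pos: "lam > 0"
    and lasso: "sqrt_lasso X Y lam \<beta>hat"
    and lam0_pos: "lam0 > 0"
    and lam0_noise: "lam0 * norm_n \<epsilon> \<ge> infnorm (\<epsilon> v* X) / real CARD('n)"
    and eta: "\<eta> = sqrt 2 - 1"
    and lam_gt: "lam * \<eta> > lam0"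
    and beta0_small: "norm_l1 \<beta>0 \<le> norm_n \<epsilon> * ((lam * \<eta> - lam0) / (2 * lam0 * lam))"
    and delta: "0 \<le> \<delta>" "\<delta> < 1"
    and L: "L = (lam * \<eta> + lam0 + \<delta> * (lam * \<eta> - lam0)) / ((1 - \<delta>) * (lam * \<eta> - lam0))"
  shows "ereal (2 * \<delta> * (lam * \<eta> - lam0) * norm_n \<epsilon> * norm_l1 (\<beta>hat - \<beta>0)
            + (norm_n (X *v (\<beta>hat - \<beta>0)))\<^sup>2)
    \<le> (MIN S\<in>UNIV.
         (INF \<beta>\<in>{\<beta>. supp_vec \<beta> = S}.
            ereal (2 * \<delta> * (lam * \<eta> - lam0) * norm_n \<epsilon> * norm_l1 (\<beta> - \<beta>0)
              + (norm_n (X *v (\<beta> - \<beta>0)))\<^sup>2))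
         + compat_term
             (((lam * \<eta> + lam0 + \<delta> * (lam * \<eta> - lam0)) / \<eta>)\<^sup>2
                * ((lam * \<eta> + lam0) / (2 * lam0))\<^sup>2 * (norm_n \<epsilon>)\<^sup>2)
             X L S)"
proof -
  define e where "e = norm_n \<epsilon>"
  define r where "r = norm_n (Y - X *v \<beta>hat)"
  define U where "U = (lam * \<eta> + lam0) / (2 * lam0)"
  define M where "M = lam * \<eta> - lam0"
  define A where "A = lam * \<eta> + lam0 + \<delta> * M"
  \<comment> \<open>Since \<open>e \<le> k\<close> and \<open>r = k * \<eta>\<close>, the noise
    terms in \<open>e\<close> and the penalty terms in \<open>r\<close> get the common factor
    \<open>k\<close>.\<close>
  define k where "k = r / \<eta>"
  have Y: "Y = X *v \<beta>0 + \<epsilon>" using beta0 noise by simp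
  have eta0: "0 < \<eta>" by (simp add: eta)
  have M: "0 < M" using lam_gt by (simp add: M_def)
  have A: "0 < A"
    using mult_pos_pos[OF lam_pos eta0] mult_nonneg_nonneg[OF delta(1) less_imp_le[OF M]] lam0_pos
    unfolding A_def by linarith
  have dM: "0 < (1 - \<delta>) * M" using delta M by simp
  have L_eq: "L = A / ((1 - \<delta>) * M)" by (simp add: L A_def M_def)
  then have L0: "0 \<le> L" using A dM by simp
  have e0: "0 \<le> e" and r0: "0 \<le> r" by (simp_all add: e_def r_def)
  have res: "\<eta> * e \<le> r" "r \<le> U * e"
    using sqrt_lasso_residual_bounds[OF lasso[unfolded Y] lam_pos lam0_pos lam0_noise eta beta0_small]
    by (simp_all add: Y e_def r_def U_def)
  have k0: "0 \<le> k" using r0 eta0 by (simp add: k_def)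
  have ek: "e \<le> k" using res(1) eta0 by (simp add: k_def field_simps)
  have rk: "r = k * \<eta>" using eta0 by (simp add: k_def)
  have kA: "k * A \<le> A / \<eta> * U * e"
    using mult_right_mono[OF res(2), of "A / \<eta>"] A eta0 by (simp add: k_def mult_ac)
  define lhs where "lhs b = 2 * \<delta> * M * e * norm_l1 (b - \<beta>0) + (norm_n (X *v (b - \<beta>0)))\<^sup>2" for b
  have sharp: "ereal (lhs \<beta>hat) \<le> ereal (lhs \<beta>) + compat_term ((A / \<eta>)\<^sup>2 * U\<^sup>2 * e\<^sup>2) X L (supp_vec \<beta>)"
    for \<beta>
  proof -
    define S where "S = supp_vec \<beta>"
    define h where "h = \<beta>hat - \<beta>"
    define x where "x = norm_l1 (restrict_vec S h)"
    define y where "y = norm_l1 (restrict_vec (- S) h)"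
    \<comment> \<open>With \<open>k\<close> factored out, \<open>x\<close> collects
      \<open>lam * \<eta> + lam0 + \<delta> * M = A\<close> and \<open>y\<close> collects
      \<open>- lam * \<eta> + lam0 + \<delta> * M = - (1 - \<delta>) * M\<close>.\<close>
    define R where "R = k * (A * x - (1 - \<delta>) * M * y)"
    define Q where "Q = (X *v h) \<bullet> (X *v (\<beta>hat - \<beta>0)) / real CARD('n)"
    \<comment> \<open>Twice the second summand is the l1-term that arises when
      \<open>\<beta>hat - \<beta>0\<close> is split at \<open>\<beta>\<close>.\<close>
    define P where "P = Q + \<delta> * M * e * (x + y)"
    have x0: "0 \<le> x" and y0: "0 \<le> y" by (simp_all add: x_def y_def)
    have hxy: "norm_l1 h = x + y"
      unfolding x_def y_def by (rule norm_l1_restrict_split)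
    have "(Y - X *v \<beta>hat) \<bullet> (X *v (\<beta> - \<beta>hat)) / real CARD('n) \<le> lam * r * (norm_l1 \<beta> - norm_l1 \<beta>hat)"
      using sqrt_lasso_first_order[OF lasso less_imp_le[OF lam_pos]] by (simp add: r_def)
    moreover have "\<dots> \<le> lam * r * (x - y)"
      using norm_l1_diff_supp[of \<beta> \<beta>hat] lam_pos r0
      by (intro mult_left_mono) (simp_all add: x_def y_def S_def h_def)
    moreover have "(Y - X *v \<beta>hat) \<bullet> (X *v (\<beta> - \<beta>hat)) / real CARD('n)
        = Q - \<epsilon> \<bullet> (X *v h) / real CARD('n)"
    proof -
      have "Y - X *v \<beta>hat = \<epsilon> - X *v (\<beta>hat - \<beta>0)"
        by (simp add: Y matrix_vector_mult_diff_distrib)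
      moreover have "X *v (\<beta> - \<beta>hat) = - (X *v h)"
        by (simp add: h_def matrix_vector_mult_diff_distrib)
      ultimately show ?thesis
        by (simp add: Q_def inner_diff_left inner_commute[of "X *v h"] diff_divide_distrib)
    qed
    moreover have "\<epsilon> \<bullet> (X *v h) / real CARD('n) \<le> lam0 * e * (x + y)"
      using noise_inner_bound[OF lam0_noise, of h] by (simp add: hxy e_def)
    moreover have "lam0 * e * (x + y) \<le> lam0 * k * (x + y)"
      using ek lam0_pos x0 y0 by (intro mult_right_mono mult_left_mono) auto
    moreover have "\<delta> * M * e * (x + y) \<le> \<delta> * M * k * (x + y)"
      using ek delta M x0 y0 by (intro mult_right_mono mult_left_mono) auto
    moreover have "lam * r * (x - y) + lam0 * k * (x + y) + \<delta> * M * k * (x + y)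
        = k * (A * x - (1 - \<delta>) * M * y)"
      by (simp add: rk A_def M_def algebra_simps)
    ultimately have main: "P \<le> R"
      unfolding P_def R_def by linarith
    have "X *v h - X *v (\<beta>hat - \<beta>0) = - (X *v (\<beta> - \<beta>0))"
      by (simp add: h_def matrix_vector_mult_diff_distrib)
    then have Q2: "2 * Q = (norm_n (X *v h))\<^sup>2 + (norm_n (X *v (\<beta>hat - \<beta>0)))\<^sup>2
        - (norm_n (X *v (\<beta> - \<beta>0)))\<^sup>2"
      unfolding Q_def inner_polarization_norm_n by (simp add: norm_n_def)
    have "2 * \<delta> * M * e * norm_l1 (\<beta>hat - \<beta>0) \<le> 2 * \<delta> * M * e * (x + y + norm_l1 (\<beta> - \<beta>0))"
      using norm_l1_diff_triangle[of \<beta>hat \<beta>0 \<beta>] delta M e0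
      by (intro mult_left_mono) (simp_all add: hxy[symmetric] h_def)
    then have red: "lhs \<beta>hat \<le> lhs \<beta> + 2 * P - (norm_n (X *v h))\<^sup>2"
      using Q2 by (simp add: lhs_def P_def algebra_simps)
    show ?thesis
    proof (cases "S = {}")
      case True
      then have "x = 0" by (simp add: x_def norm_l1_def restrict_vec_def)
      then have "R \<le> 0"
        using k0 dM y0 by (simp add: R_def mult_nonneg_nonneg)
      then have "lhs \<beta>hat \<le> lhs \<beta>"
        using main red zero_le_power2[of "norm_n (X *v h)"] by linarith
      then show ?thesis using True by (simp add: compat_term_def S_def)
    next
      case False
      show ?thesis
      proof (cases "compat_sq X L S = 0")
        case True
        then show ?thesis using False by (simp add: compat_term_def S_def)
      next
        case phi: False
        define \<phi> where "\<phi> = compat_sq X L S"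
        have phi0: "0 < \<phi>"
          using phi compat_sq_nonneg[OF False L0, of X] by (simp add: \<phi>_def)
        define T where "T = (A / \<eta> * U * e)\<^sup>2 * real (card S) / \<phi>"
        have T0: "0 \<le> T" using phi0 by (simp add: T_def)
        have "2 * P \<le> (norm_n (X *v h))\<^sup>2 + T"
        \<comment> \<open>\<open>L\<close> is the ratio of the coefficients of \<open>x\<close> and
          \<open>y\<close> in \<open>R\<close>: either \<open>R\<close> is nonpositive, or
          \<open>h\<close> lies in the cone \<open>y \<le> L * x\<close>.\<close>
        proof (cases "A * x \<le> (1 - \<delta>) * M * y")
          case True
          then have "R \<le> 0"
            using k0 by (simp add: R_def mult_nonneg_nonpos)
          then show ?thesis
            using main T0 zero_le_power2[of "norm_n (X *v h)"] by linarith
        next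
          case cone: False
          \<comment> \<open>The strict failure of the case condition excludes \<open>x = 0\<close>,
            so \<open>h\<close> can be normalized on \<open>S\<close>.\<close>
          have xpos: "0 < x"
          proof (rule ccontr)
            assume "\<not> 0 < x"
            then have "x = 0" using x0 by simp
            then show False using cone dM y0 by simp
          qed
          have "y \<le> L * x"
            using cone dM unfolding L_eq by (simp add: field_simps)
          then have "\<phi> * x\<^sup>2 \<le> real (card S) * (norm_n (X *v h))\<^sup>2"
            using compat_sq_cone[of S h L X] xpos by (simp add: \<phi>_def x_def y_def)
          then have "2 * (k * A * x) \<le> (norm_n (X *v h))\<^sup>2 + T"
            unfolding T_def
            by (rule weighted_am_gm_bound) (use phi0 kA k0 A x0 in auto)
          moreover have "R \<le> k * (A * x)"
            unfolding R_def using k0 dM y0 by (intro mult_left_mono) (simp_all add: mult_nonneg_nonneg)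
          ultimately show ?thesis using main by (simp add: mult.assoc)
        qed
        then have "lhs \<beta>hat \<le> lhs \<beta> + T" using red by linarith
        moreover have "compat_term ((A / \<eta>)\<^sup>2 * U\<^sup>2 * e\<^sup>2) X L S = ereal T"
          using False phi by (simp add: compat_term_def T_def \<phi>_def power_mult_distrib power_divide)
        ultimately show ?thesis by (simp add: S_def)
      qed
    qed
  qed
  have "ereal (lhs \<beta>hat) \<le> (INF \<beta>\<in>{\<beta>. supp_vec \<beta> = S}. ereal (lhs \<beta>))
      + compat_term ((A / \<eta>)\<^sup>2 * U\<^sup>2 * e\<^sup>2) X L S" for S
  proof (cases "compat_term ((A / \<eta>)\<^sup>2 * U\<^sup>2 * e\<^sup>2) X L S")
    case (real c)
    \<comment> \<open>The compatibility term depends on \<open>\<beta>\<close> only through its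
      support, so a finite value can be moved across before taking the infimum.\<close>
    have "ereal (lhs \<beta>hat) - ereal c \<le> (INF \<beta>\<in>{\<beta>. supp_vec \<beta> = S}. ereal (lhs \<beta>))"
    proof (rule INF_greatest)
      fix \<beta> assume "\<beta> \<in> {\<beta>. supp_vec \<beta> = S}"
      then show "ereal (lhs \<beta>hat) - ereal c \<le> ereal (lhs \<beta>)"
        using sharp[of \<beta>] real by simp
    qed
    then show ?thesis
      unfolding real by (subst (asm) ereal_minus_le) (simp_all add: add.commute)
  next
    case PInf
    then show ?thesis by simp
  next
    case MInf
    then show ?thesis by (simp add: compat_term_def split: if_splits)
  qed
  then show ?thesis
    by (simp add: lhs_def e_def M_def A_def U_def)
qed

end
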